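(* Let $s:\mathbb N\to\mathbb N$ be a strictly increasing function and $\alpha,\beta$ ordinals below $\varepsilon_0$ (with $\beta+1+\alpha<\varepsilon_0$). (i) If $s\in\mathscr F_\beta$, then $\mathbf F_{\alpha,s}\subseteq\mathbf F_{\beta+1+\alpha}$. (ii) If $s(x)\le F_\beta(x)$ for all $x\in\mathbb N$, then $\mathbf F_{\alpha,s}\subseteq\mathbf F_{\beta+\alpha}$.
   Context: Ordinals are below $\varepsilon_0$ in Cantor normal form. Standard fundamental sequences of limit ordinals: $(\gamma+\omega^{\beta+1})(x)=\gamma+\omega^\beta\cdot(x+1)$, $(\gamma+\omega^{\lambda'})(x)=\gamma+\omega^{\lambda'(x)}$ for $\lambda'$ limit. Fast-growing functions: $F_0(x)=x+1$, $F_{\alpha+1}(x)=F_\alpha^{x+1}(x)$, $F_\lambda(x)=F_{\lambda(x)}(x)$. For a monotone $s:\mathbb N\to\mathbb N$, the $s$-fundamental sequences are $(\gamma+\omega^{\beta+1})(x)_s=\gamma+\omega^\beta\cdot s(x)$ and $(\gamma+\omega^{\lambda'})(x)_s=\gamma+\omega^{\lambda'(x)_s}$ for $\lambda'$ limit, and $F_{0,s}(x)=x+1$, $F_{\alpha+1,s}(x)=F_{\alpha,s}^{s(x)}(x)$, $F_{\lambda,s}(x)=F_{\lambda(x)_s,s}(x)$. Extended Grzegorczyk class $\mathscr F_\alpha$: smallest class of functions $\mathbb N^k\to\mathbb N$ containing the zero function, addition, projections and $F_\alpha$ (standard version), closed under composition and limited primitive recursion (primitive recursion bounded by some function of the class applied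 to the max of the arguments). $\mathscr F_{<\alpha}=\bigcup_{\beta<\alpha}\mathscr F_\beta$. $\mathrm{DTime}(t(n))$: languages decided by a deterministic Turing machine in at most $t(n)$ steps on inputs of length $n$. $\mathbf F_\alpha=\bigcup_{p\in\mathscr F_{<\alpha}}\mathrm{DTime}(F_\alpha(p(n)))$ and $\mathbf F_{\alpha,s}=\bigcup_{p\in\mathscr F_{<\alpha}}\mathrm{DTime}(F_{\alpha,s}(p(n)))$, with $p$ unary. *)

theory Defs
  imports Main
begin

section \<open>Ordinals below epsilon-0 in Cantor normal form\<close>

text \<open>
  \<open>Cnf [b1, ..., bn]\<close> stands for the formal sum \<open>\<omega>^b1 + ... + \<omega>^bn\<close>, and \<open>Cnf []\<close> for 0.
  Coefficients are written out: \<open>\<omega>^b * m\<close> is a block of \<open>m\<close> equal exponents \<open>b\<close>.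
  The ordinals below epsilon-0 are exactly the terms satisfying \<open>is_cnf\<close> below, in which the
  exponents are hereditarily weakly decreasing; other terms are junk.
\<close>

datatype cnf = Cnf "cnf list"

fun exponents :: "cnf \<Rightarrow> cnf list" where
  "exponents (Cnf as) = as"

fun lt_cnf :: "cnf \<Rightarrow> cnf \<Rightarrow> bool" where
  "lt_cnf (Cnf as) (Cnf []) = False"
| "lt_cnf (Cnf []) (Cnf (b # bs)) = True"
| "lt_cnf (Cnf (a # as)) (Cnf (b # bs)) = (lt_cnf a b \<or> a = b \<and> lt_cnf (Cnf as) (Cnf bs))"

lemma lt_cnf_irrefl: "\<not> lt_cnf a a"
proof (induction "size a" arbitrary: a rule: less_induct)
  case less
  obtain as where a: "a = Cnf as" by (cases a)
  show ?case
  proof (cases as)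
    case Nil
    then show ?thesis by (simp add: a)
  next
    case (Cons x xs)
    then show ?thesis using less[of x] less[of "Cnf xs"] by (simp add: a)
  qed
qed

lemma lt_cnf_trans: "lt_cnf a b \<Longrightarrow> lt_cnf b c \<Longrightarrow> lt_cnf a c"
proof (induction a b arbitrary: c rule: lt_cnf.induct)
  case (3 a as b bs)
  then show ?case
    by (cases c rule: exponents.cases; cases "exponents c") auto
next
  case (2 b bs)
  then show ?case
    by (cases c rule: exponents.cases; cases "exponents c") auto
qed auto

lemma lt_cnf_total: "lt_cnf a b \<or> a = b \<or> lt_cnf b a"
proof (induction a b rule: lt_cnf.induct)
  case (1 as)
  then show ?case by (cases as) auto
qed auto

instantiation cnf :: "{linorder, zero, one, plus}"
begin

definition less_cnf :: "cnf \<Rightarrow> cnf \<Rightarrow> bool" where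
  "a < b \<longleftrightarrow> lt_cnf a b"

definition less_eq_cnf :: "cnf \<Rightarrow> cnf \<Rightarrow> bool" where
  "a \<le> b \<longleftrightarrow> lt_cnf a b \<or> a = b"

definition zero_cnf :: cnf where
  "0 = Cnf []"

definition one_cnf :: cnf where
  "1 = Cnf [0]"

text \<open>Ordinal addition: the terms of \<open>a\<close> below the leading term of \<open>b\<close> are absorbed.\<close>

definition plus_cnf :: "cnf \<Rightarrow> cnf \<Rightarrow> cnf" where
  "a + b = (case exponents b of
      [] \<Rightarrow> a
    | e # es \<Rightarrow> Cnf (takeWhile (\<lambda>c. e \<le> c) (exponents a) @ e # es))"

instance
proof
  fix x y z :: cnf
  show "(x < y) = (x \<le> y \<and> \<not> y \<le> x)"
    using lt_cnf_irrefl lt_cnf_trans by (auto simp: less_cnf_def less_eq_cnf_def)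
  show "x \<le> x" by (simp add: less_eq_cnf_def)
  show "x \<le> y \<Longrightarrow> y \<le> z \<Longrightarrow> x \<le> z"
    using lt_cnf_trans by (auto simp: less_eq_cnf_def)
  show "x \<le> y \<Longrightarrow> y \<le> x \<Longrightarrow> x = y"
    using lt_cnf_irrefl lt_cnf_trans by (auto simp: less_eq_cnf_def)
  show "x \<le> y \<or> y \<le> x"
    using lt_cnf_total by (auto simp: less_eq_cnf_def)
qed

end

fun is_cnf :: "cnf \<Rightarrow> bool" where
  "is_cnf (Cnf as) \<longleftrightarrow> (\<forall>a\<in>set as. is_cnf a) \<and> sorted_wrt (\<ge>) as"

definition is_succ :: "cnf \<Rightarrow> bool" where
  "is_succ a \<longleftrightarrow> exponents a \<noteq> [] \<and> last (exponents a) = 0"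

text \<open>The predecessor of a successor ordinal.\<close>

definition cnf_pred :: "cnf \<Rightarrow> cnf" where
  "cnf_pred a = Cnf (butlast (exponents a))"


section \<open>Fundamental sequences and fast-growing functions\<close>

lemma size_last_exponent: "exponents a \<noteq> [] \<Longrightarrow> size (last (exponents a)) < size a"
proof (cases a)
  case (Cnf as)
  assume "exponents a \<noteq> []"
  then have "last as \<in> set as" using Cnf by simp
  then have "size (last as) \<le> size_list size as"
    by (simp add: size_list_estimation')
  then show ?thesis using Cnf by simp
qed

text \<open>
  \<open>fundseq s a x\<close> is \<open>a(x)_s\<close>. It is meaningful for limit ordinals \<open>a\<close> only (on 0 and on
  successors the value is a dummy); see the lemmas \<open>fundseq_succ\<close> and \<open>fundseq_limit\<close>.
\<close>

function fundseq :: "(nat \<Rightarrow> nat) \<Rightarrow> cnf \<Rightarrow> nat \<Rightarrow> cnf" where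
  "fundseq s a x =
    (if exponents a = [] then 0
     else let g = butlast (exponents a); b = last (exponents a) in
       if is_succ b then Cnf (g @ replicate (s x) (cnf_pred b))
       else if b = 0 then Cnf g
       else Cnf (g @ [fundseq s b x]))"
  by pat_completeness auto
termination
  by (relation "measure (\<lambda>(s, a, x). size a)") (auto simp: size_last_exponent)

declare fundseq.simps [simp del]

lemma fundseq_succ:
  "fundseq s (Cnf (g @ [Cnf (bs @ [0])])) x = Cnf (g @ replicate (s x) (Cnf bs))"
  by (subst fundseq.simps) (simp add: is_succ_def cnf_pred_def)

lemma fundseq_limit:
  assumes "b \<noteq> 0" and "\<not> is_succ b"
  shows "fundseq s (Cnf (g @ [b])) x = Cnf (g @ [fundseq s b x])"
  using assms by (subst fundseq.simps) simp

text \<open>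
  Termination of the fast-growing recursion. The relation \<open>descent\<close> contains the steps
  from a successor to its predecessor and from a limit to each member of its fundamental sequence.
\<close>

inductive descent :: "cnf \<Rightarrow> cnf \<Rightarrow> bool" where
  descent_pred: "descent (Cnf g) (Cnf (g @ [0]))"
| descent_exp: "descent c b \<Longrightarrow> descent (Cnf (g @ replicate n c)) (Cnf (g @ [b]))"

lemma accp_descent_snoc:
  assumes "Wellfounded.accp descent b"
  shows "Wellfounded.accp descent (Cnf g) \<Longrightarrow> Wellfounded.accp descent (Cnf (g @ [b]))"
  using assms
proof (induction b arbitrary: g rule: accp.induct)
  case (accI b)
  have rep: "Wellfounded.accp descent (Cnf (g @ replicate n c))" if "descent c b" for c n
  proof (induction n)
    case 0
    then show ?case using accI by simp
  next
    case (Suc n)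
    then show ?case
      using accI.IH[OF that, of "g @ replicate n c"] by (simp add: replicate_append_same)
  qed
  show ?case
  proof (rule accpI)
    fix y assume "descent y (Cnf (g @ [b]))"
    then show "Wellfounded.accp descent y"
      by cases (use accI rep in auto)
  qed
qed

lemma wfp_descent: "wfp descent"
proof (rule accp_wfpI, rule allI)
  fix a
  show "Wellfounded.accp descent a"
  proof (induction a)
    case (Cnf as)
    then show ?case
    proof (induction as rule: rev_induct)
      case Nil
      show ?case by (rule accpI) (auto elim: descent.cases)
    next
      case (snoc b bs)
      then show ?case by (intro accp_descent_snoc) auto
    qed
  qed
qed

lemma descent_cnf_pred: "is_succ a \<Longrightarrow> descent (cnf_pred a) a"
proof -
  assume a: "is_succ a"
  then have "a = Cnf (butlast (exponents a) @ [0])"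
    by (cases a) (simp add: is_succ_def, metis append_butlast_last_id)
  then show ?thesis by (metis cnf_pred_def descent_pred)
qed

lemma descent_fundseq: "a \<noteq> 0 \<Longrightarrow> \<not> is_succ a \<Longrightarrow> descent (fundseq s a x) a"
proof (induction "size a" arbitrary: a rule: less_induct)
  case less
  define g where "g = butlast (exponents a)"
  define b where "b = last (exponents a)"
  have ne: "exponents a \<noteq> []"
    using less.prems(1) by (cases a) (simp add: zero_cnf_def)
  then have a: "a = Cnf (g @ [b])" by (cases a) (simp add: g_def b_def)
  have b0: "b \<noteq> 0" using less.prems(2) by (simp add: a is_succ_def)
  show ?case
  proof (cases "is_succ b")
    case True
    then have "fundseq s a x = Cnf (g @ replicate (s x) (cnf_pred b))"
      by (subst fundseq.simps) (simp add: a)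
    then show ?thesis using descent_exp[OF descent_cnf_pred[OF True]] a by simp
  next
    case False
    have "descent (fundseq s b x) b"
      by (rule less.hyps) (use size_last_exponent[OF ne] b0 False in \<open>auto simp: b_def\<close>)
    from descent_exp[OF this, of g 1] show ?thesis
      using fundseq_limit[OF b0 False] a by simp
  qed
qed

text \<open>\<open>fast_s s a\<close> is the function \<open>F_{a,s}\<close> and \<open>fast a\<close> is the standard \<open>F_a\<close>.\<close>

function fast_s :: "(nat \<Rightarrow> nat) \<Rightarrow> cnf \<Rightarrow> nat \<Rightarrow> nat" where
  "fast_s s a =
    (if a = 0 then (\<lambda>x. x + 1)
     else if is_succ a then (\<lambda>x. (fast_s s (cnf_pred a) ^^ s x) x)
     else (\<lambda>x. fast_s s (fundseq s a x) x))"
  by pat_completeness auto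
termination
proof (relation "inv_image {(a, b). descent a b} snd")
  show "wf (inv_image {(a, b). descent a b} snd)"
    using wfp_descent by (simp add: wfp_def)
qed (auto simp: descent_cnf_pred descent_fundseq)

declare fast_s.simps [simp del]

text \<open>The standard fundamental sequences and fast-growing functions are the case \<open>s(x) = x + 1\<close>.\<close>

abbreviation fast :: "cnf \<Rightarrow> nat \<Rightarrow> nat" where
  "fast \<equiv> fast_s (\<lambda>x. x + 1)"

lemma fast_s_zero: "fast_s s 0 x = x + 1"
  by (simp add: fast_s.simps)

lemma fast_s_succ: "fast_s s (Cnf (as @ [0])) x = (fast_s s (Cnf as) ^^ s x) x"
  by (subst fast_s.simps) (simp add: is_succ_def cnf_pred_def zero_cnf_def)

lemma fast_s_limit: "a \<noteq> 0 \<Longrightarrow> \<not> is_succ a \<Longrightarrow> fast_s s a x = fast_s s (fundseq s a x) x"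
  by (subst fast_s.simps) simp


section \<open>The extended Grzegorczyk hierarchy\<close>

text \<open>
  \<open>grz a k f\<close>: the \<open>k\<close>-ary function \<open>f\<close> is in the class of index \<open>a\<close>. A function from
  \<open>k\<close>-tuples of naturals to the naturals is represented by a function on lists of which only the
  values on lists of length \<open>k\<close> matter; all clauses respect this.
\<close>

inductive grz :: "cnf \<Rightarrow> nat \<Rightarrow> (nat list \<Rightarrow> nat) \<Rightarrow> bool" for a :: cnf where
  grz_zero:
    "(\<And>xs. length xs = k \<Longrightarrow> f xs = 0) \<Longrightarrow> grz a k f"
| grz_add:
    "(\<And>x y. f [x, y] = x + y) \<Longrightarrow> grz a 2 f"
| grz_proj:
    "i < k \<Longrightarrow> (\<And>xs. length xs = k \<Longrightarrow> f xs = xs ! i) \<Longrightarrow> grz a k f"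
| grz_fast:
    "(\<And>x. f [x] = fast a x) \<Longrightarrow> grz a 1 f"
| grz_comp:
    "grz a (length gs) h \<Longrightarrow> (\<And>g. g \<in> set gs \<Longrightarrow> grz a k g) \<Longrightarrow>
     (\<And>xs. length xs = k \<Longrightarrow> f xs = h (map (\<lambda>g. g xs) gs)) \<Longrightarrow> grz a k f"
| grz_limited_rec:
    "grz a k g \<Longrightarrow> grz a (k + 2) h \<Longrightarrow> grz a 1 b \<Longrightarrow>
     (\<And>xs. length xs = k \<Longrightarrow> f (0 # xs) = g xs) \<Longrightarrow>
     (\<And>y xs. length xs = k \<Longrightarrow> f (Suc y # xs) = h (f (y # xs) # y # xs)) \<Longrightarrow>
     (\<And>y xs. length xs = k \<Longrightarrow> f (y # xs) \<le> b [Max (set (y # xs))]) \<Longrightarrow>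
     grz a (k + 1) f"

definition Grz :: "cnf \<Rightarrow> (nat \<Rightarrow> nat) set" where
  "Grz a = {p. grz a 1 (\<lambda>xs. p (hd xs))}"

definition Grz_below :: "cnf \<Rightarrow> (nat \<Rightarrow> nat) set" where
  "Grz_below a = (\<Union>b\<in>{b. is_cnf b \<and> b < a}. Grz b)"


section \<open>Deterministic time classes\<close>

text \<open>
  Deterministic multi-tape Turing machines with two-way infinite tapes. States and symbols are
  drawn from finite sets of natural numbers. A step reads the symbols under all heads, and then
  writes and moves on every tape. The input is written on the first tape, starting under the head.
\<close>

datatype move = MLeft | MStay | MRight

fun move_head :: "move \<Rightarrow> int \<Rightarrow> int" where
  "move_head MLeft i = i - 1"
| "move_head MStay i = i"
| "move_head MRight i = i + 1"

record tm =
  num_tapes :: nat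
  states :: "nat set"
  input_symbols :: "nat set"
  tape_symbols :: "nat set"
  blank :: nat
  start :: nat
  accept :: nat
  reject :: nat
  delta :: "nat \<Rightarrow> nat list \<Rightarrow> nat \<times> (nat \<times> move) list"

definition tm_wf :: "tm \<Rightarrow> bool" where
  "tm_wf M \<longleftrightarrow>
     num_tapes M \<ge> 1 \<and> finite (states M) \<and> finite (tape_symbols M) \<and>
     input_symbols M \<subseteq> tape_symbols M \<and> blank M \<in> tape_symbols M - input_symbols M \<and>
     {start M, accept M, reject M} \<subseteq> states M \<and> accept M \<noteq> reject M \<and>
     (\<forall>q \<in> states M - {accept M, reject M}. \<forall>v \<in> lists (tape_symbols M).
        length v = num_tapes M \<longrightarrow>
        (case delta M q v of (q', acts) \<Rightarrow>
           q' \<in> states M \<and> length acts = num_tapes M \<and> fst ` set acts \<subseteq> tape_symbols M))"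

text \<open>A configuration consists of a state and, for each tape, the head position and the contents.\<close>

type_synonym config = "nat \<times> (int \<times> (int \<Rightarrow> nat)) list"

definition initial :: "tm \<Rightarrow> nat list \<Rightarrow> config" where
  "initial M w =
     (start M,
      (0, \<lambda>i. if 0 \<le> i \<and> i < int (length w) then w ! nat i else blank M)
      # replicate (num_tapes M - 1) (0, \<lambda>_. blank M))"

fun step :: "tm \<Rightarrow> config \<Rightarrow> config" where
  "step M (q, ts) =
     (if q = accept M \<or> q = reject M then (q, ts)
      else let (q', acts) = delta M q (map (\<lambda>(i, t). t i) ts) in
        (q', map2 (\<lambda>(i, t) (c, m). (move_head m i, t(i := c))) ts acts))"

text \<open>Halting configurations are fixed points of \<open>step\<close>, so \<open>step M ^^ n\<close> runs for at most \<open>n\<close> steps.\<close>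

definition decides_in_time :: "tm \<Rightarrow> (nat \<Rightarrow> nat) \<Rightarrow> nat list set \<Rightarrow> bool" where
  "decides_in_time M t L \<longleftrightarrow>
     L \<subseteq> lists (input_symbols M) \<and>
     (\<forall>w \<in> lists (input_symbols M).
        fst ((step M ^^ t (length w)) (initial M w)) = (if w \<in> L then accept M else reject M))"

text \<open>A language is a set of words over some finite set of natural numbers.\<close>

definition DTime :: "(nat \<Rightarrow> nat) \<Rightarrow> nat list set set" where
  "DTime t = {L. \<exists>M. tm_wf M \<and> decides_in_time M t L}"


section \<open>Fast-growing complexity classes\<close>

definition FF_s :: "(nat \<Rightarrow> nat) \<Rightarrow> cnf \<Rightarrow> nat list set set" where
  "FF_s s a = (\<Union>p\<in>Grz_below a. DTime (\<lambda>n. fast_s s a (p n)))"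

definition FF :: "cnf \<Rightarrow> nat list set set" where
  "FF a = (\<Union>p\<in>Grz_below a. DTime (\<lambda>n. fast a (p n)))"

end

theory Submission
  imports Defs
begin

text \<open>
  If \<open>\<tau>\<close> is monotone, exceeds \<open>s\<close> by a suitable constant and satisfies
  \<open>\<tau>(x + 1) \<le> F_\<delta>(\<tau>(x))\<close>, then \<open>\<tau>(F_{\<alpha>,s}(x)) \<le> F_{\<delta>+\<alpha>}(\<tau>(x))\<close> by induction on \<open>\<alpha>\<close>.
  The hierarchies are compared across different fundamental sequences and across the absorption of
  terms in \<open>\<delta> + \<alpha>\<close> by one principle: if \<open>\<alpha> < \<beta>\<close> and no coefficient of \<open>\<alpha>\<close> exceeds \<open>x\<close>,
  then \<open>F_\<alpha>(x) \<le> F_\<beta>(x)\<close>. If \<open>s \<le> F_\<beta>\<close>, one takes \<open>\<delta> = \<beta>\<close> and for \<open>\<tau>\<close> essentially \<open>s\<close> plus a constant;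
  if \<open>s\<close> is in the class of index \<open>\<beta>\<close>, one takes \<open>\<delta> = \<beta> + 1\<close> and for \<open>\<tau>\<close> an iterate of \<open>F_\<beta>\<close>.
  Since \<open>\<tau>\<close> and the inner function \<open>p\<close> are bounded by iterates of a function in the class of index
  \<open>\<delta> + \<gamma>\<close> for some \<open>\<gamma> < \<alpha>\<close>, no inclusion between the Grzegorczyk classes is needed.
\<close>

section \<open>Order and fundamental sequences\<close>

lemma less_Cnf_simps [simp]:
  "\<not> Cnf as < Cnf []"
  "Cnf [] < Cnf (b # bs)"
  "Cnf (a # as) < Cnf (b # bs) \<longleftrightarrow> a < b \<or> a = b \<and> Cnf as < Cnf bs"
  by (cases as; auto simp: less_cnf_def)+

lemma zero_le_cnf [simp]: "(0 :: cnf) \<le> a"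
  by (cases a rule: exponents.cases; cases "exponents a")
    (auto simp: zero_cnf_def le_less)

lemma not_less_zero_cnf [simp]: "\<not> a < (0 :: cnf)"
  by (simp add: not_less)

lemma zero_less_cnf: "(0 :: cnf) < a \<longleftrightarrow> a \<noteq> 0"
  by (auto simp: order.strict_iff_order)

lemma less_append_cancel [simp]: "Cnf (g @ r) < Cnf (g @ t) \<longleftrightarrow> Cnf r < Cnf t"
  by (induction g) auto

lemma le_append_cancel [simp]: "Cnf (g @ r) \<le> Cnf (g @ t) \<longleftrightarrow> Cnf r \<le> Cnf t"
  by (auto simp: le_less)

text \<open>Locates the first difference. Either it lies within \<open>g\<close> (or
  \<open>as\<close> is a proper prefix of \<open>g\<close>) and the tail after \<open>g\<close> is
  irrelevant, or \<open>as\<close> extends \<open>g\<close> and only the remainder \<open>r\<close>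
  is compared.\<close>

lemma less_snoc_cases:
  "Cnf as < Cnf (g @ [b]) \<Longrightarrow>
    (\<forall>t. Cnf as < Cnf (g @ t)) \<or> (\<exists>r. as = g @ r \<and> (r = [] \<or> hd r < b))"
proof (induction g arbitrary: as)
  case Nil
  then show ?case by (cases as) auto
next
  case (Cons a g)
  then show ?case by (cases as) auto
qed

lemma less_succ_imp_le: "Cnf as < Cnf (bs @ [0]) \<Longrightarrow> Cnf as \<le> Cnf bs"
  using less_snoc_cases[of as bs 0] by (auto simp: le_less dest: spec[of _ "[]"])

lemma less_snoc: "Cnf g < Cnf (g @ b # bs)"
  using less_append_cancel[of g "[]" "b # bs"] by simp

lemma is_succ_snoc [simp]: "is_succ (Cnf (as @ [b])) \<longleftrightarrow> b = 0"
  by (simp add: is_succ_def)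

lemma Cnf_snoc_nonzero [simp]: "Cnf (as @ [b]) \<noteq> 0"
  by (simp add: zero_cnf_def)

lemma is_cnf_snoc:
  "is_cnf (Cnf (g @ [b])) \<longleftrightarrow> is_cnf (Cnf g) \<and> is_cnf b \<and> (\<forall>a\<in>set g. b \<le> a)"
  by (auto simp: sorted_wrt_append)

lemma is_succ_obtain:
  assumes "is_succ a"
  obtains as where "a = Cnf (as @ [0])"
  using assms by (cases a) (auto simp: is_succ_def, metis append_butlast_last_id)

lemma nonzero_obtain:
  assumes "a \<noteq> 0"
  obtains g b where "a = Cnf (g @ [b])"
  using assms by (cases a) (auto simp: zero_cnf_def, metis append_butlast_last_id)

text \<open>Follows the recursion of \<open>fundseq\<close> into the last exponent, ending where
  that exponent is a successor.\<close>

lemma limit_induct [consumes 2, case_names succ limit]: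
  assumes "a \<noteq> 0" and "\<not> is_succ a"
    and succ: "\<And>g bs. P (Cnf (g @ [Cnf (bs @ [0])]))"
    and limit: "\<And>g b. b \<noteq> 0 \<Longrightarrow> \<not> is_succ b \<Longrightarrow> P b \<Longrightarrow> P (Cnf (g @ [b]))"
  shows "P a"
  using assms(1,2)
proof (induction "size a" arbitrary: a rule: less_induct)
  case less
  obtain g b where a: "a = Cnf (g @ [b])" using nonzero_obtain[OF less.prems(1)] .
  have b0: "b \<noteq> 0" using less.prems(2) a by simp
  have sz: "size b < size a" using size_last_exponent[of a] a by simp
  show ?case
  proof (cases "is_succ b")
    case True
    then show ?thesis using succ a by (metis is_succ_obtain)
  next
    case False
    then show ?thesis using limit[OF b0 False] less.hyps[OF sz b0 False] a by simp
  qed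
qed

text \<open>Transfinite induction shaped like the recursion of \<open>fast_s\<close>. The limit
  hypothesis covers every \<open>s\<close>, so one rule serves both hierarchies.\<close>

lemma cnf_descent_induct [case_names zero succ limit]:
  assumes zero: "P 0"
    and succ: "\<And>as. P (Cnf as) \<Longrightarrow> P (Cnf (as @ [0]))"
    and limit: "\<And>a. a \<noteq> 0 \<Longrightarrow> \<not> is_succ a \<Longrightarrow> (\<And>s x. P (fundseq s a x)) \<Longrightarrow> P a"
  shows "P a"
proof (induction a rule: wfp_induct_rule[OF wfp_descent])
  case (1 a)
  show ?case
  proof (cases "a = 0 \<or> is_succ a")
    case True
    then show ?thesis
      using zero succ 1 descent_pred by (metis is_succ_obtain)
  next
    case False
    then show ?thesis using limit 1 descent_fundseq by blast
  qed
qed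

lemma le_replicate_mono: "m \<le> n \<Longrightarrow> Cnf (replicate m c) \<le> Cnf (replicate n c)"
proof (induction m arbitrary: n)
  case 0
  then show ?case using zero_le_cnf[unfolded zero_cnf_def] by simp
next
  case (Suc m)
  then show ?case by (cases n) (auto simp: le_less)
qed

lemma fundseq_less: "a \<noteq> 0 \<Longrightarrow> \<not> is_succ a \<Longrightarrow> fundseq s a x < a"
proof (induction a rule: limit_induct)
  case (succ g bs)
  have "Cnf bs < Cnf (bs @ [0])" by (rule less_snoc)
  then have "Cnf (replicate (s x) (Cnf bs)) < Cnf [Cnf (bs @ [0])]"
    by (cases "s x") auto
  then show ?case by (simp add: fundseq_succ)
next
  case (limit g b)
  then show ?case by (simp add: fundseq_limit)
qed

lemma fundseq_mono:
  "a \<noteq> 0 \<Longrightarrow> \<not> is_succ a \<Longrightarrow> s x \<le> s y \<Longrightarrow> fundseq s a x \<le> fundseq s a y"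
proof (induction a rule: limit_induct)
  case (succ g bs)
  then show ?case by (simp add: fundseq_succ le_replicate_mono)
next
  case (limit g b)
  then show ?case by (auto simp add: fundseq_limit le_less)
qed

lemma is_cnf_append_replicate:
  "is_cnf (Cnf g) \<Longrightarrow> is_cnf c \<Longrightarrow> \<forall>a\<in>set g. c \<le> a \<Longrightarrow>
    is_cnf (Cnf (g @ replicate n c))"
proof (induction n)
  case (Suc n)
  then have "is_cnf (Cnf ((g @ replicate n c) @ [c]))"
    by (subst is_cnf_snoc) auto
  then show ?case by (simp add: replicate_append_same)
qed simp

lemma is_cnf_fundseq:
  "a \<noteq> 0 \<Longrightarrow> \<not> is_succ a \<Longrightarrow> is_cnf a \<Longrightarrow> is_cnf (fundseq s a x)"
proof (induction a rule: limit_induct)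
  case (succ g bs)
  have "Cnf bs < Cnf (bs @ [0])" by (rule less_snoc)
  moreover have "is_cnf (Cnf bs)" "\<forall>a\<in>set g. Cnf (bs @ [0]) \<le> a" "is_cnf (Cnf g)"
    using succ by (simp_all add: is_cnf_snoc del: is_cnf.simps)
  ultimately show ?case
    unfolding fundseq_succ by (meson is_cnf_append_replicate less_imp_le order_trans)
next
  case (limit g b)
  have "fundseq s b x < b" using limit fundseq_less by blast
  then have "\<forall>a\<in>set g. fundseq s b x \<le> a"
    using limit.prems unfolding is_cnf_snoc by (meson less_imp_le order_trans)
  then show ?case using limit unfolding fundseq_limit[OF limit.hyps] is_cnf_snoc by blast
qed

text \<open>Since coefficients are written out, a coefficient is the multiplicity of an exponent.\<close>

fun coeffs_le :: "nat \<Rightarrow> cnf \<Rightarrow> bool" where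
  "coeffs_le n (Cnf as) \<longleftrightarrow> (\<forall>a\<in>set as. coeffs_le n a) \<and> (\<forall>a. count_list as a \<le> n)"

lemma coeffs_le_mono: "coeffs_le m a \<Longrightarrow> m \<le> n \<Longrightarrow> coeffs_le n a"
  by (induction m a rule: coeffs_le.induct) (auto intro: order_trans)

lemma length_le_size_list: "length as \<le> size_list f as"
  by (induction as) auto

lemma coeffs_le_size: "coeffs_le (size a) a"
proof (induction a)
  case (Cnf as)
  have "coeffs_le (size (Cnf as)) a" if "a \<in> set as" for a
    using Cnf[OF that] coeffs_le_mono size_list_estimation'[OF that, of "size a" size] by fastforce
  moreover have "count_list as a \<le> size (Cnf as)" for a
    using count_le_length[of as a] length_le_size_list[of as size] by simp
  ultimately show ?case by simp
qed

lemma coeffs_le_snocD: "coeffs_le n (Cnf (g @ [b])) \<Longrightarrow> coeffs_le n (Cnf g) \<and> coeffs_le n b"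
  by (auto dest: spec intro: le_trans[OF le_add1])

lemma count_list_replicate: "count_list (replicate n c) a = (if a = c then n else 0)"
  by (induction n) auto

text \<open>The exponent introduced by \<open>fundseq\<close> is strictly below the removed last
  one, hence below all exponents in \<open>g\<close>. It therefore merges with no existing block,
  and the only new coefficients are 1 and \<open>s x\<close>.\<close>

lemma coeffs_le_fundseq:
  "a \<noteq> 0 \<Longrightarrow> \<not> is_succ a \<Longrightarrow> is_cnf a \<Longrightarrow> coeffs_le n a \<Longrightarrow> s x \<le> n \<Longrightarrow>
    coeffs_le n (fundseq s a x)"
proof (induction a rule: limit_induct)
  case (succ g bs)
  have "Cnf bs < Cnf (bs @ [0])" by (rule less_snoc)
  then have "Cnf bs \<notin> set g"
    using succ.prems(1) by (auto simp: is_cnf_snoc simp del: is_cnf.simps)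
  moreover have "coeffs_le n (Cnf g)" "coeffs_le n (Cnf bs)"
    using coeffs_le_snocD succ.prems(2) by blast+
  ultimately show ?case
    using succ.prems(3) by (auto simp: fundseq_succ count_list_replicate)
next
  case (limit g b)
  have "fundseq s b x < b" using limit fundseq_less by blast
  then have "fundseq s b x \<notin> set g"
    using limit.prems(1) by (auto simp: is_cnf_snoc simp del: is_cnf.simps)
  moreover have "coeffs_le n (Cnf g)" "coeffs_le n b"
    using coeffs_le_snocD limit.prems(2) by blast+
  \<comment> \<open>The last exponent \<open>b\<close> itself occurs, so \<open>n\<close> has room
    for the single copy of \<open>fundseq s b x\<close>.\<close>
  moreover have "1 \<le> n"
    using limit.prems(2) by (auto dest: spec[of _ b])
  ultimately show ?case
    using limit by (auto simp: fundseq_limit is_cnf_snoc simp del: is_cnf.simps)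
qed

text \<open>Among the first n + 1 positions of \<open>r\<close>, at most n carry \<open>c\<close>;
  at another one \<open>r\<close> has ended or has a smaller exponent.\<close>

lemma less_replicate:
  "\<forall>a\<in>set r. a \<le> c \<Longrightarrow> count_list r c \<le> n \<Longrightarrow> Cnf r < Cnf (replicate (Suc n) c)"
proof (induction r arbitrary: n)
  case Nil
  then show ?case by simp
next
  case (Cons a r)
  then show ?case by (cases n) (auto simp: le_less)
qed

text \<open>If \<open>c\<close> agrees with \<open>a\<close> on \<open>g\<close>, its remainder has
  smaller exponents, with at most n copies of the predecessor exponent in the successor case. The n
  + 1 copies in the standard sequence exceed this; the limit case passes to the leading exponent of
  the remainder.\<close>

lemma less_fundseq:
  "a \<noteq> 0 \<Longrightarrow> \<not> is_succ a \<Longrightarrow> is_cnf c \<Longrightarrow> c < a \<Longrightarrow> coeffs_le n c \<Longrightarrow>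
    c < fundseq (\<lambda>x. x + 1) a n"
proof (induction a arbitrary: c rule: limit_induct)
  case (succ g bs)
  obtain cs where c: "c = Cnf cs" by (cases c)
  show ?case
  proof (cases "\<forall>t. Cnf cs < Cnf (g @ t)")
    case True
    then show ?thesis by (simp add: c fundseq_succ)
  next
    case False
    then obtain r where r: "cs = g @ r" "r = [] \<or> hd r < Cnf (bs @ [0])"
      using less_snoc_cases succ.prems(2) c by blast
    have "\<forall>a\<in>set r. a \<le> Cnf bs"
    proof (cases r)
      case (Cons a r')
      then have "a \<le> Cnf bs" using r less_succ_imp_le by (cases a) auto
      then show ?thesis using succ.prems(1) c r Cons by (auto simp: sorted_wrt_append)
    qed simp
    moreover have "count_list r (Cnf bs) \<le> n"
      using succ.prems(3) c r(1) by (auto dest: spec[of _ "Cnf bs"])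
    ultimately show ?thesis
      using less_replicate[of r "Cnf bs" n] by (simp add: c r(1) fundseq_succ)
  qed
next
  case (limit g b)
  obtain cs where c: "c = Cnf cs" by (cases c)
  show ?case
  proof (cases "\<forall>t. Cnf cs < Cnf (g @ t)")
    case True
    then show ?thesis using limit by (simp add: c fundseq_limit)
  next
    case False
    then obtain r where r: "cs = g @ r" "r = [] \<or> hd r < b"
      using less_snoc_cases limit.prems(2) c by blast
    show ?thesis
    proof (cases r)
      case Nil
      then show ?thesis using limit by (simp add: c r(1) fundseq_limit less_snoc)
    next
      case (Cons a r')
      then have "a < fundseq (\<lambda>x. x + 1) b n"
        using limit r c by auto
      then show ?thesis using limit Cons by (simp add: c r(1) fundseq_limit)
    qed
  qed
qed

section \<open>Fast-growing functions\<close>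

lemma funpow_ge:
  fixes f :: "nat \<Rightarrow> nat"
  assumes "\<And>y. y \<le> f y"
  shows "x \<le> (f ^^ n) x"
  by (induction n) (auto intro: le_trans assms)

lemma funpow_ge_add:
  fixes f :: "nat \<Rightarrow> nat"
  assumes "\<And>y. y < f y"
  shows "x + n \<le> (f ^^ n) x"
proof (induction n)
  case (Suc n)
  then show ?case using assms[of "(f ^^ n) x"] by simp
qed simp

lemma funpow_le_funpow:
  fixes f :: "nat \<Rightarrow> nat"
  assumes "\<And>y. y \<le> f y" and "m \<le> n"
  shows "(f ^^ m) x \<le> (f ^^ n) x"
  using funpow_ge[of f "(f ^^ m) x" "n - m"] assms funpow_add[of "n - m" m f] by simp

lemma fast_s_ge: "x \<le> fast_s s a x"
proof (induction a arbitrary: x rule: cnf_descent_induct)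
  case zero
  then show ?case by (simp add: fast_s_zero)
next
  case (succ as)
  then show ?case by (simp add: fast_s_succ funpow_ge)
next
  case (limit a)
  then show ?case by (simp add: fast_s_limit)
qed

lemma fast_gt: "x < fast a x"
proof (induction a arbitrary: x rule: cnf_descent_induct)
  case zero
  then show ?case by (simp add: fast_s_zero)
next
  case (succ as)
  then show ?case
    using funpow_ge_add[of "fast (Cnf as)" x "x + 1"] by (simp add: fast_s_succ)
next
  case (limit a)
  then show ?case by (simp add: fast_s_limit)
qed

lemma fast_ge: "x \<le> fast a x"
  using fast_gt[of x a] by simp

declare fast_gt[simplified, simp] fast_ge[simplified, simp]

lemma fast_succ: "fast (Cnf (as @ [0])) x = (fast (Cnf as) ^^ (x + 1)) x"
  by (rule fast_s_succ)

text \<open>At a limit, \<open>less_fundseq\<close> puts \<open>a\<close> below the member with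
  index \<open>x\<close>, so the induction stays at the fixed argument \<open>x\<close>. At a
  successor, \<open>a\<close> is at most the predecessor, whose function is iterated at least
  once.\<close>

lemma fast_mono_index:
  "is_cnf a \<Longrightarrow> is_cnf b \<Longrightarrow> a < b \<Longrightarrow> coeffs_le x a \<Longrightarrow> fast a x \<le> fast b x"
proof (induction b rule: cnf_descent_induct)
  case zero
  then show ?case by simp
next
  case (succ as)
  have "a \<le> Cnf as" using less_succ_imp_le succ.prems(3) by (cases a) blast
  then have "fast a x \<le> fast (Cnf as) x"
    using succ by (auto simp: le_less is_cnf_snoc simp del: is_cnf.simps coeffs_le.simps)
  also have "\<dots> \<le> (fast (Cnf as) ^^ (x + 1)) x"
    using funpow_le_funpow[of "fast (Cnf as)" 1 "x + 1" x] by simp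
  finally show ?case by (simp only: fast_succ)
next
  case (limit b)
  have "fast a x \<le> fast (fundseq (\<lambda>x. x + 1) b x) x"
    using limit is_cnf_fundseq less_fundseq by blast
  then show ?case using limit by (simp add: fast_s_limit[of b])
qed

lemma fast_mono_index_le:
  "is_cnf a \<Longrightarrow> is_cnf b \<Longrightarrow> a \<le> b \<Longrightarrow> coeffs_le x a \<Longrightarrow> fast a x \<le> fast b x"
  using fast_mono_index by (auto simp: le_less)

lemma funpow_mono_ge:
  fixes f :: "nat \<Rightarrow> nat"
  assumes mono: "\<And>x y. c \<le> x \<Longrightarrow> x \<le> y \<Longrightarrow> f x \<le> f y"
    and ge: "\<And>y. y \<le> f y" and "c \<le> x" "x \<le> y"
  shows "(f ^^ n) x \<le> (f ^^ n) y"
proof (induction n)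
  case (Suc n)
  have "c \<le> (f ^^ n) x" using funpow_ge[of f x n] ge \<open>c \<le> x\<close> by (meson le_trans)
  then show ?case using mono Suc by simp
qed (use assms in simp)

text \<open>
  Monotonicity in fact holds at all arguments, but above the coefficients of the index the limit
  case reduces to \<open>fast_mono_index\<close>, and this range is all that is needed.
\<close>

lemma fast_strict_mono:
  "is_cnf a \<Longrightarrow> coeffs_le (Suc x) a \<Longrightarrow> x < y \<Longrightarrow> fast a x < fast a y"
proof (induction a arbitrary: x y rule: cnf_descent_induct)
  case zero
  then show ?case by (simp add: fast_s_zero)
next
  case (succ as)
  let ?f = "fast (Cnf as)"
  have c: "is_cnf (Cnf as)" "coeffs_le (Suc x) (Cnf as)"
    using succ.prems coeffs_le_snocD is_cnf_snoc by blast+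
  have lt: "?f u < ?f v" if "x \<le> u" "u < v" for u v
    using succ.IH[OF c(1) coeffs_le_mono[OF c(2)], of u v] that by simp
  have "(?f ^^ n) x < (?f ^^ n) y" for n
  proof (induction n)
    case (Suc n)
    then show ?case using lt[of "(?f ^^ n) x"] funpow_ge[of ?f x n] by simp
  qed (use succ.prems in simp)
  then have "(?f ^^ (x + 1)) x < (?f ^^ (x + 1)) y" .
  also have "\<dots> \<le> (?f ^^ (y + 1)) y"
    using succ.prems(3) by (intro funpow_le_funpow) auto
  finally show ?case by (simp only: fast_succ)
next
  case (limit a)
  let ?a = "fundseq (\<lambda>x. x + 1) a"
  have c: "is_cnf (?a z)" for z using is_cnf_fundseq limit by blast
  \<comment> \<open>Member \<open>x\<close> of the standard sequence may contain x + 1 copies of an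
    exponent, hence \<open>Suc x\<close> in the statement; since x < y, the bound carries over to
    \<open>y\<close>.\<close>
  have cl: "coeffs_le (Suc x) (?a x)"
    using coeffs_le_fundseq limit by simp
  have "fast (?a x) x < fast (?a x) y"
    using limit c cl by blast
  also have "\<dots> \<le> fast (?a y) y"
    using c limit.prems(3) coeffs_le_mono[OF cl, of y] limit.hyps
    by (intro fast_mono_index_le fundseq_mono) auto
  finally show ?case using limit by (simp add: fast_s_limit[of a])
qed

lemma fast_mono: "is_cnf a \<Longrightarrow> coeffs_le x a \<Longrightarrow> x \<le> y \<Longrightarrow> fast a x \<le> fast a y"
  using fast_strict_mono[of a x y] coeffs_le_mono[of x a "Suc x"] by (auto simp: le_less)

lemma fast_add_le: "is_cnf a \<Longrightarrow> coeffs_le x a \<Longrightarrow> fast a x + n \<le> fast a (x + n)"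
proof (induction n)
  case (Suc n)
  then have "fast a (x + n) < fast a (Suc (x + n))"
    using coeffs_le_mono by (intro fast_strict_mono) auto
  then show ?case using Suc by simp
qed simp


section \<open>Ordinal addition\<close>

lemma add_Cnf_simps [simp]:
  "a + Cnf [] = a"
  "Cnf ds + Cnf (e # es) = Cnf (takeWhile ((\<le>) e) ds @ e # es)"
  by (simp_all add: plus_cnf_def)

lemma add_zero_cnf [simp]: "a + (0 :: cnf) = a"
  by (simp add: zero_cnf_def)

text \<open>A trailing exponent 0 absorbs nothing, so d + (a + 1) = (d + a) + 1. This aligns the
  successor steps of the two hierarchies.\<close>

lemma add_Cnf_snoc_zero: "d + Cnf (as @ [0]) = Cnf (exponents (d + Cnf as) @ [0])"
proof -
  obtain ds where "d = Cnf ds" by (cases d)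
  moreover have "takeWhile ((\<le>) 0) ds = ds" by simp
  ultimately show ?thesis by (cases as) auto
qed

lemma is_cnf_add:
  assumes "is_cnf d" and "is_cnf a"
  shows "is_cnf (d + a)"
proof -
  obtain ds as where da: "d = Cnf ds" "a = Cnf as" by (cases d; cases a)
  have "set (takeWhile P ds) \<subseteq> set ds" "sorted_wrt (\<ge>) (takeWhile P ds)" for P
    using assms(1) sorted_wrt_append[of "(\<ge>)" "takeWhile P ds" "dropWhile P ds"]
    by (auto simp: da dest: set_takeWhileD)
  then show ?thesis
    using assms unfolding da
    by (cases as) (auto simp: sorted_wrt_append dest!: set_takeWhileD intro: order_trans)
qed

text \<open>Absorption only deletes terms of \<open>d\<close>, but the last surviving block may
  merge with the leading block of \<open>a\<close>, so coefficients can add up.\<close>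

lemma coeffs_le_add:
  assumes "coeffs_le m d" and "coeffs_le n a"
  shows "coeffs_le (m + n) (d + a)"
proof -
  obtain ds as where da: "d = Cnf ds" "a = Cnf as" by (cases d; cases a)
  have "count_list (takeWhile P ds) x \<le> m" for P x
  proof -
    have "count_list (takeWhile P ds @ dropWhile P ds) x \<le> m"
      using assms(1) da by simp
    then show ?thesis unfolding count_list_append by linarith
  qed
  then have "count_list (takeWhile P ds @ as) x \<le> m + n" for P x
    using assms(2) da by (simp add: add_mono)
  moreover have "coeffs_le (m + n) x" if "x \<in> set ds \<union> set as" for x
    using that assms da by (auto intro: coeffs_le_mono)
  ultimately show ?thesis
    using assms(1) coeffs_le_mono[of m d "m + n"] unfolding da
    by (cases as) (auto dest!: set_takeWhileD simp del: count_list_append count_list.simps)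
qed

text \<open>If the leading exponents satisfy e' < e, the sums first differ where \<open>d\<close>
  stops having exponents at least \<open>e\<close>: there one sum has \<open>e\<close>, the other
  something smaller. Equal leading exponents absorb the same terms.\<close>

lemma add_strict_mono_cnf:
  assumes "c < a"
  shows "d + c < d + (a :: cnf)"
proof -
  obtain ds cs as where dca: "d = Cnf ds" "c = Cnf cs" "a = Cnf as" by (cases d; cases c; cases a)
  obtain e es where as: "as = e # es" using assms dca by (cases as) auto
  show ?thesis
  proof (cases cs)
    case Nil
    have "Cnf ds < Cnf (takeWhile ((\<le>) e) ds @ e # es)" by (induction ds) auto
    then show ?thesis by (simp add: dca as Nil)
  next
    case (Cons e' es')
    have "Cnf (takeWhile ((\<le>) e') ds @ e' # es') < Cnf (takeWhile ((\<le>) e) ds @ e # es)"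
      if "e' < e" using that by (induction ds) auto
    then show ?thesis using assms by (auto simp: dca as Cons)
  qed
qed

lemma le_add_left_cnf: "(d :: cnf) \<le> d + a"
  using add_strict_mono_cnf[of 0 a d] by (cases "a = 0") (auto simp: zero_less_cnf)

lemma Cnf_le_Cons: "sorted_wrt (\<ge>) (e # es) \<Longrightarrow> Cnf es \<le> Cnf (e # es)"
  by (induction es arbitrary: e) (auto simp: le_less)

text \<open>The surviving terms of \<open>d\<close> have exponents at least the leading one of
  \<open>a\<close>, and prepending such terms cannot decrease a sorted sum.\<close>

lemma le_add_right_cnf:
  assumes "is_cnf a"
  shows "a \<le> d + a"
proof -
  obtain ds as where da: "d = Cnf ds" "a = Cnf as" by (cases d; cases a)
  show ?thesis
  proof (cases as)
    case Nil
    then show ?thesis using zero_le_cnf[of d] by (simp add: da zero_cnf_def)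
  next
    case (Cons e es)
    have "Cnf (e # es) \<le> Cnf (ps @ e # es)" if "\<forall>p\<in>set ps. e \<le> p" for ps
      using that
    proof (induction ps)
      case (Cons p ps)
      then have "Cnf es \<le> Cnf (ps @ e # es)"
        using Cnf_le_Cons[of e es] assms da \<open>as = e # es\<close> by (auto intro: order_trans)
      then show ?case using Cons.prems by (auto simp: le_less)
    qed simp
    then show ?thesis by (auto simp: da Cons dest: set_takeWhileD)
  qed
qed

section \<open>Comparison of the two hierarchies\<close>

text \<open>
  Monotonicity of the target functions in the index, which only holds at arguments above the
  coefficients of the smaller index, is available here because \<open>\<tau>\<close> dominates \<open>s\<close>,
  hence the coefficients of all ordinals met by the recursion.
\<close>

lemma fast_s_le_fast:
  assumes d: "is_cnf d" and mono: "mono \<tau>"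
    and s: "\<And>x. s x + size d \<le> \<tau> x"
    and step: "\<And>x. \<tau> (x + 1) \<le> fast d (\<tau> x)"
  shows "is_cnf a \<Longrightarrow> coeffs_le m a \<Longrightarrow> m + size d \<le> \<tau> x \<Longrightarrow>
    \<tau> (fast_s s a x) \<le> fast (d + a) (\<tau> x)"
proof (induction a arbitrary: m x rule: cnf_descent_induct)
  case zero
  then show ?case using step[of x] by (simp add: fast_s_zero)
next
  case (succ as)
  let ?f = "fast (d + Cnf as)" and ?g = "fast_s s (Cnf as)"
  have c: "is_cnf (Cnf as)" "coeffs_le m (Cnf as)"
    using succ.prems coeffs_le_snocD is_cnf_snoc by blast+
  have cl: "coeffs_le (\<tau> x) (d + Cnf as)"
    using succ.prems(3) by (intro coeffs_le_mono[OF coeffs_le_add[OF coeffs_le_size c(2)]]) simp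
  \<comment> \<open>\<tau> is moved past one application at a time; the iterates only increase, so
    the coefficient bound at \<open>x\<close> persists.\<close>
  have "\<tau> ((?g ^^ j) x) \<le> (?f ^^ j) (\<tau> x)" for j
  proof (induction j)
    case (Suc j)
    have \<tau>j: "\<tau> x \<le> \<tau> ((?g ^^ j) x)"
      using mono funpow_ge[OF fast_s_ge] by (simp add: monoD)
    then have "\<tau> (?g ((?g ^^ j) x)) \<le> ?f (\<tau> ((?g ^^ j) x))"
      using succ.IH[OF c] succ.prems(3) by simp
    also have "\<dots> \<le> ?f ((?f ^^ j) (\<tau> x))"
      using Suc cl \<tau>j is_cnf_add[OF d c(1)] by (blast intro: fast_mono coeffs_le_mono)
    finally show ?case by simp
  qed simp
  then have "\<tau> ((?g ^^ s x) x) \<le> (?f ^^ s x) (\<tau> x)" .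
  also have "\<dots> \<le> (?f ^^ (\<tau> x + 1)) (\<tau> x)"
    using s[of x] by (intro funpow_le_funpow fast_ge) simp
  finally show ?case
    unfolding fast_s_succ add_Cnf_snoc_zero fast_succ by (cases "d + Cnf as") simp
next
  case (limit a)
  let ?c = "fundseq s a x"
  have c: "is_cnf ?c" "?c < a" using limit is_cnf_fundseq fundseq_less by auto
  have cl: "coeffs_le (max m (s x)) ?c"
    using limit by (intro coeffs_le_fundseq) (auto intro: coeffs_le_mono)
  have mx: "max m (s x) + size d \<le> \<tau> x" using limit.prems(3) s[of x] by simp
  have "\<tau> (fast_s s ?c x) \<le> fast (d + ?c) (\<tau> x)"
    using limit.IH c(1) cl mx by blast
  \<comment> \<open>The ordinal \<open>d + ?c\<close> need not be a member of the standard sequence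
    of \<open>d + a\<close>; being smaller, with coefficients at most \<open>\<tau> x\<close>, is
    enough.\<close>
  also have "\<dots> \<le> fast (d + a) (\<tau> x)"
    using limit.prems c d coeffs_le_add[OF coeffs_le_size cl, of d] mx
    by (intro fast_mono_index is_cnf_add add_strict_mono_cnf) (auto intro: coeffs_le_mono)
  finally show ?case using limit.hyps by (simp add: fast_s_limit[of a])
qed

section \<open>Bounds in the Grzegorczyk classes\<close>

lemma Grz_comp:
  assumes "p \<in> Grz a" and "q \<in> Grz a"
  shows "(\<lambda>x. p (q x)) \<in> Grz a"
proof -
  have "grz a (length [\<lambda>xs. q (hd xs)]) (\<lambda>xs. p (hd xs))"
    using assms(1) by (simp add: Grz_def)
  then have "grz a 1 (\<lambda>xs. p (q (hd xs)))"
    by (rule grz_comp) (use assms in \<open>auto simp: Grz_def\<close>)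
  then show ?thesis by (simp add: Grz_def)
qed

lemma Grz_add:
  assumes "p \<in> Grz a" and "q \<in> Grz a"
  shows "(\<lambda>x. p x + q x) \<in> Grz a"
proof -
  let ?gs = "[\<lambda>xs. p (hd xs), \<lambda>xs. q (hd xs)]"
  have "grz a 2 (\<lambda>xs. xs ! 0 + xs ! 1)" by (rule grz_add) simp
  then have "grz a (length ?gs) (\<lambda>xs. xs ! 0 + xs ! 1)" by (simp add: numeral_2_eq_2)
  then have "grz a 1 (\<lambda>xs. p (hd xs) + q (hd xs))"
    by (rule grz_comp) (use assms in \<open>auto simp: Grz_def\<close>)
  then show ?thesis by (simp add: Grz_def)
qed

lemma Grz_zero: "(\<lambda>x. 0) \<in> Grz a"
  unfolding Grz_def by (simp add: grz_zero)

lemma Grz_id: "(\<lambda>x. x) \<in> Grz a"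
proof -
  have "grz a 1 hd" by (rule grz_proj[of 0]) (auto simp: length_Suc_conv)
  then show ?thesis by (simp add: Grz_def)
qed

lemma Grz_fast: "fast a \<in> Grz a"
  unfolding Grz_def using grz_fast[of "\<lambda>xs. fast a (hd xs)" a] by simp

lemma Grz_funpow:
  assumes "p \<in> Grz a" and "q \<in> Grz a"
  shows "(\<lambda>x. (p ^^ n) (q x)) \<in> Grz a"
proof (induction n)
  case (Suc n)
  from Grz_comp[OF assms(1) Suc] show ?case by simp
qed (use assms in simp)

text \<open>
  The iterates of \<open>grz_bound a\<close> are cofinal in \<open>Grz a\<close>. The additive constant is only a
  constant function of the class that is at least \<open>size a\<close>, so that \<open>fast a\<close> is evaluated
  where it is known to be monotone.
\<close>

definition grz_bound :: "cnf \<Rightarrow> nat \<Rightarrow> nat" where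
  "grz_bound a x = fast a (2 * x + (fast a ^^ size a) 0)"

lemma grz_bound_in_Grz: "(grz_bound a ^^ n) \<in> Grz a"
proof -
  have "(\<lambda>x. x + x + (fast a ^^ size a) 0) \<in> Grz a"
    using Grz_add Grz_id Grz_funpow[OF Grz_fast Grz_zero] by blast
  from Grz_comp[OF Grz_fast this] have "grz_bound a \<in> Grz a"
    unfolding grz_bound_def[abs_def] by (simp add: mult_2)
  from Grz_funpow[OF this Grz_id] show ?thesis .
qed

lemma size_le_funpow_fast: "size a \<le> (fast a ^^ size a) 0"
  using funpow_ge_add[of "fast a" 0 "size a"] by simp

lemma grz_bound_gt: "2 * x < grz_bound a x"
  unfolding grz_bound_def using fast_gt[of "2 * x + (fast a ^^ size a) 0" a] by linarith

lemma grz_bound_ge: "x \<le> grz_bound a x"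
  using grz_bound_gt[of x a] by simp

lemma mono_grz_bound:
  assumes "is_cnf a"
  shows "mono (grz_bound a)"
proof (rule monoI)
  fix x y :: nat
  assume "x \<le> y"
  then show "grz_bound a x \<le> grz_bound a y"
    unfolding grz_bound_def using size_le_funpow_fast[of a]
    by (intro fast_mono assms coeffs_le_mono[OF coeffs_le_size]) auto
qed

text \<open>Each application more than doubles its argument. Iterates thus absorb additive constants
  and linear terms in later bounds.\<close>

lemma grz_bound_funpow_linear: "(n + 1) * x + n \<le> (grz_bound a ^^ n) x"
proof (induction n)
  case (Suc n)
  have "(Suc n + 1) * x + Suc n \<le> 2 * ((n + 1) * x + n) + 1" by (simp add: algebra_simps)
  also have "\<dots> \<le> 2 * (grz_bound a ^^ n) x + 1" using Suc by simp
  also have "\<dots> \<le> (grz_bound a ^^ Suc n) x"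
    using grz_bound_gt[of "(grz_bound a ^^ n) x" a] by simp
  finally show ?case .
qed simp

lemma add_le_grz_bound_funpow: "x + n \<le> (grz_bound a ^^ n) x"
  using grz_bound_funpow_linear[of n x a] by (simp add: algebra_simps)

lemma fast_le_grz_bound:
  assumes "is_cnf a" and "size a \<le> x"
  shows "fast a x \<le> grz_bound a x"
  unfolding grz_bound_def
  by (rule fast_mono[OF assms(1) coeffs_le_mono[OF coeffs_le_size assms(2)]]) simp

lemma fast_le_grz_bound_funpow:
  assumes "is_cnf a"
  shows "\<exists>n. \<forall>x. fast a x \<le> (grz_bound a ^^ n) x"
proof (intro exI allI)
  fix x
  \<comment> \<open>Monotonicity is available only from \<open>size a\<close> on; the sum covers the
    finitely many smaller arguments.\<close>
  let ?n = "1 + (\<Sum>x<size a. fast a x)"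
  show "fast a x \<le> (grz_bound a ^^ ?n) x"
  proof (cases "size a \<le> x")
    case True
    have "fast a x \<le> (grz_bound a ^^ 1) x" using fast_le_grz_bound[OF assms True] by simp
    also have "\<dots> \<le> (grz_bound a ^^ ?n) x" by (intro funpow_le_funpow grz_bound_ge) simp
    finally show ?thesis .
  next
    case False
    then have "fast a x \<le> (\<Sum>x<size a. fast a x)" by (intro member_le_sum) auto
    then show ?thesis using add_le_grz_bound_funpow[of x ?n a] by linarith
  qed
qed

text \<open>Composition adds iteration counts, and limited recursion inherits the count of its bound
  \<open>b\<close>. The extra 0 makes the maximum meaningful for the empty tuple.\<close>

lemma grz_le_grz_bound:
  assumes a: "is_cnf a"
  shows "grz a k f \<Longrightarrow>
    \<exists>n. \<forall>xs. length xs = k \<longrightarrow> f xs \<le> (grz_bound a ^^ n) (Max (set (0 # xs)))"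
proof (induction rule: grz.induct)
  case (grz_zero k f)
  then show ?case by auto
next
  case (grz_add f)
  have "x + y \<le> (grz_bound a ^^ 1) (Max {0, x, y})" for x y
    using grz_bound_gt[of "max x y" a] by simp
  then show ?case
    by (intro exI[of _ 1]) (auto simp: numeral_2_eq_2 length_Suc_conv grz_add)
next
  case (grz_proj i k f)
  then show ?case by (intro exI[of _ 0]) (auto intro!: Max_ge)
next
  case (grz_fast f)
  obtain n where "\<And>x. fast a x \<le> (grz_bound a ^^ n) x"
    using fast_le_grz_bound_funpow[OF a] by blast
  then show ?case
    using grz_fast by (intro exI[of _ n]) (auto simp: length_Suc_conv)
next
  case (grz_comp gs h k f)
  let ?B = "grz_bound a"
  obtain n where n: "\<And>ys. length ys = length gs \<Longrightarrow> h ys \<le> (?B ^^ n) (Max (set (0 # ys)))"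
    using grz_comp.IH(1) by blast
  have "\<exists>m. \<forall>g\<in>set gs. \<forall>xs. length xs = k \<longrightarrow> g xs \<le> (?B ^^ m) (Max (set (0 # xs)))"
    using grz_comp.IH(2)
  proof (induction gs)
    case (Cons g gs)
    then obtain m where m:
      "\<And>g xs. g \<in> set gs \<Longrightarrow> length xs = k \<Longrightarrow> g xs \<le> (?B ^^ m) (Max (set (0 # xs)))"
      by (metis list.set_intros(2))
    obtain l where l: "\<And>xs. length xs = k \<Longrightarrow> g xs \<le> (?B ^^ l) (Max (set (0 # xs)))"
      using Cons.prems by (meson list.set_intros(1))
    have "(?B ^^ m) x \<le> (?B ^^ (m + l)) x" "(?B ^^ l) x \<le> (?B ^^ (m + l)) x" for x
      by (auto intro!: funpow_le_funpow grz_bound_ge)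
    then have "\<And>h xs. h \<in> set (g # gs) \<Longrightarrow> length xs = k \<Longrightarrow>
        h xs \<le> (?B ^^ (m + l)) (Max (set (0 # xs)))"
      using m l by (metis le_trans set_ConsD)
    then show ?case by blast
  qed simp
  then obtain m where
    m: "\<And>g xs. g \<in> set gs \<Longrightarrow> length xs = k \<Longrightarrow> g xs \<le> (?B ^^ m) (Max (set (0 # xs)))"
    by blast
  have "f xs \<le> (?B ^^ (n + m)) (Max (set (0 # xs)))" if "length xs = k" for xs
  proof -
    let ?ys = "map (\<lambda>g. g xs) gs"
    have "f xs \<le> (?B ^^ n) (Max (set (0 # ?ys)))" using n[of ?ys] grz_comp.hyps that by simp
    also have "\<dots> \<le> (?B ^^ n) ((?B ^^ m) (Max (set (0 # xs))))"
      using m[OF _ that] by (intro funpow_mono mono_grz_bound[OF a]) (auto simp del: Max_insert)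
    finally show ?thesis by (simp add: funpow_add)
  qed
  then show ?case by blast
next
  case (grz_limited_rec k g h b f)
  then obtain n where n: "\<And>x. b [x] \<le> (grz_bound a ^^ n) x"
  proof -
    obtain n where "\<And>xs. length xs = 1 \<Longrightarrow> b xs \<le> (grz_bound a ^^ n) (Max (set (0 # xs)))"
      using grz_limited_rec.IH(3) by blast
    from this[of "[_]"] show thesis by (intro that[of n]) simp
  qed
  have "f zs \<le> (grz_bound a ^^ n) (Max (set (0 # zs)))" if len: "length zs = k + 1" for zs
  proof -
    obtain y xs where zs: "zs = y # xs" "length xs = k"
      using len by (cases zs) simp_all
    have "f zs \<le> b [Max (set zs)]" using grz_limited_rec zs by simp
    also have "\<dots> \<le> (grz_bound a ^^ n) (Max (set zs))" by (rule n)
    also have "Max (set zs) = Max (set (0 # zs))" using zs by simp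
    finally show ?thesis .
  qed
  then show ?case by blast
qed

lemma Grz_le_grz_bound:
  assumes "is_cnf a" and "p \<in> Grz a"
  shows "\<exists>n. \<forall>x. p x \<le> (grz_bound a ^^ n) x"
proof -
  obtain n where n: "\<And>xs. length xs = 1 \<Longrightarrow> p (hd xs) \<le> (grz_bound a ^^ n) (Max (set (0 # xs)))"
    using grz_le_grz_bound[OF assms(1)] assms(2) unfolding Grz_def by blast
  have "p x \<le> (grz_bound a ^^ n) x" for x
    using n[of "[x]"] by simp
  then show ?thesis by blast
qed

lemma grz_bound_le_index:
  assumes "is_cnf a" and "is_cnf b" and "a \<le> b"
  shows "\<exists>m. \<forall>x. (grz_bound a ^^ n) x \<le> (grz_bound b ^^ m) x"
proof -
  let ?k = "(fast a ^^ size a) 0" and ?l = "(fast b ^^ size b) 0"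
  \<comment> \<open>The constant \<open>?k\<close> is supplied by \<open>?k\<close> iterates of
    \<open>grz_bound b\<close>, and one further application raises the index.\<close>
  have 1: "grz_bound a x \<le> (grz_bound b ^^ (1 + ?k)) x" for x
  proof -
    have cl: "coeffs_le (2 * x + ?k) a"
      using size_le_funpow_fast[of a] by (intro coeffs_le_mono[OF coeffs_le_size]) simp
    have "grz_bound a x \<le> fast a (2 * (x + ?k) + ?l)"
      unfolding grz_bound_def by (rule fast_mono[OF assms(1) cl]) simp
    also have "\<dots> \<le> grz_bound b (x + ?k)"
      unfolding grz_bound_def by (rule fast_mono_index_le[OF assms coeffs_le_mono[OF cl]]) simp
    also have "\<dots> \<le> grz_bound b ((grz_bound b ^^ ?k) x)"
      by (intro monoD[OF mono_grz_bound] assms add_le_grz_bound_funpow)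
    finally show ?thesis by simp
  qed
  have "(grz_bound a ^^ n) x \<le> ((grz_bound b ^^ (1 + ?k)) ^^ n) x" for x
  proof (induction n)
    case (Suc n)
    then show ?case using 1 mono_grz_bound[OF assms(1)] by (auto intro: order_trans monoD)
  qed simp
  then show ?thesis unfolding funpow_mult by blast
qed


section \<open>Complexity classes\<close>

lemma step_funpow_halted:
  "fst c = accept M \<or> fst c = reject M \<Longrightarrow> (step M ^^ n) c = c"
proof (induction n)
  case (Suc n)
  then show ?case by (cases c) simp
qed simp

lemma DTime_mono:
  assumes "\<And>n. t n \<le> t' n"
  shows "DTime t \<subseteq> DTime t'"
proof -
  have "decides_in_time M t' L" if "decides_in_time M t L" for M L
  proof -
    have "(step M ^^ t' n) c = (step M ^^ t n) c"
      if "fst ((step M ^^ t n) c) = accept M \<or> fst ((step M ^^ t n) c) = reject M" for n c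
      using step_funpow_halted[OF that, of "t' n - t n"] assms[of n]
        funpow_add[of "t' n - t n" "t n" "step M"] by simp
    then show ?thesis
      using that unfolding decides_in_time_def by (metis (full_types))
  qed
  then show ?thesis by (auto simp: DTime_def)
qed

text \<open>Common core of both parts: \<tau> applied to the old inner function is bounded by an
  iterate of \<open>grz_bound (d + c)\<close> with c < a, and this iterate becomes the new inner
  function.\<close>

lemma FF_s_subset_FF:
  assumes a: "is_cnf a" and d: "is_cnf d" and mono: "mono \<tau>"
    and s: "\<And>x. s x + size d \<le> \<tau> x"
    and ge: "\<And>x. x \<le> \<tau> x"
    and size: "\<And>x. size a + size d \<le> \<tau> x"
    and step: "\<And>x. \<tau> (x + 1) \<le> fast d (\<tau> x)"
    and bound: "\<And>x. \<tau> x \<le> (grz_bound d ^^ k) x"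
  shows "FF_s s a \<subseteq> FF (d + a)"
proof
  fix L assume "L \<in> FF_s s a"
  then obtain c p where c: "is_cnf c" "c < a" "p \<in> Grz c"
    and L: "L \<in> DTime (\<lambda>n. fast_s s a (p n))"
    by (auto simp: FF_s_def Grz_below_def)
  let ?B = "grz_bound (d + c)"
  have dc: "is_cnf (d + c)" using is_cnf_add d c(1) .
  obtain i where i: "\<And>x. p x \<le> (grz_bound c ^^ i) x"
    using Grz_le_grz_bound[OF c(1,3)] by blast
  obtain m where m: "\<And>x. (grz_bound c ^^ i) x \<le> (?B ^^ m) x"
    using grz_bound_le_index[OF c(1) dc le_add_right_cnf[OF c(1)]] by blast
  obtain l where l: "\<And>x. (grz_bound d ^^ k) x \<le> (?B ^^ l) x"
    using grz_bound_le_index[OF d dc le_add_left_cnf] by blast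
  have "\<tau> (p n) \<le> (?B ^^ (l + m)) n" for n
  proof -
    have "\<tau> (p n) \<le> (?B ^^ l) (p n)" using bound l le_trans by blast
    also have "\<dots> \<le> (?B ^^ l) ((?B ^^ m) n)"
      by (intro funpow_mono mono_grz_bound[OF dc] le_trans[OF i m])
    finally show ?thesis by (simp add: funpow_add)
  qed
  moreover have "fast_s s a (p n) \<le> fast (d + a) y" if "\<tau> (p n) \<le> y" for n y
  proof -
    have "fast_s s a (p n) \<le> \<tau> (fast_s s a (p n))" by (rule ge)
    also have "\<dots> \<le> fast (d + a) (\<tau> (p n))"
      using fast_s_le_fast[where \<tau> = \<tau> and m = "size a" and x = "p n", OF d mono s step a]
        coeffs_le_size size by blast
    also have "\<dots> \<le> fast (d + a) y"
      using that size[of "p n"] coeffs_le_add[OF coeffs_le_size coeffs_le_size, of d a]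
      by (intro fast_mono is_cnf_add d a) (auto intro: coeffs_le_mono)
    finally show ?thesis .
  qed
  ultimately have "DTime (\<lambda>n. fast_s s a (p n)) \<subseteq> DTime (\<lambda>n. fast (d + a) ((?B ^^ (l + m)) n))"
    by (intro DTime_mono) simp
  then have "L \<in> DTime (\<lambda>n. fast (d + a) ((?B ^^ (l + m)) n))" using L by (rule subsetD)
  moreover have "(?B ^^ (l + m)) \<in> Grz_below (d + a)"
    using grz_bound_in_Grz dc add_strict_mono_cnf[OF c(2)] by (auto simp: Grz_below_def)
  ultimately show "L \<in> FF (d + a)" unfolding FF_def by (rule UN_I[rotated])
qed

section \<open>The inclusion for s bounded by a fast-growing function\<close>

lemma FF_s_subset_FF_pointwise:
  assumes s: "strict_mono s" and a: "is_cnf a" and d: "is_cnf d"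
    and le: "\<And>x. s x \<le> fast d x"
  shows "FF_s s a \<subseteq> FF (d + a)"
proof -
  let ?M = "s (size d) + size d + 1" and ?K = "size a + size d"
  \<comment> \<open>The floor \<open>?M\<close> makes the step condition trivial for x + 1 at most
    \<open>size d\<close>, where \<open>fast d\<close> is not yet known to be monotone;
    \<open>?K\<close> pays for the coefficients, and \<open>x + 1\<close> lets
    \<open>fast d (x + 1)\<close> bound the next value.\<close>
  let ?\<tau> = "\<lambda>x. max (max (s x) (x + 1)) ?M + ?K"
  have mono: "mono ?\<tau>"
    using strict_mono_mono[OF s, THEN monoD] by (intro monoI) (fastforce simp: max_def)
  have step: "?\<tau> (x + 1) \<le> fast d (?\<tau> x)" for x
  proof (cases "x + 1 \<le> size d")
    case True
    then have "?\<tau> (x + 1) \<le> ?M + ?K" using strict_mono_mono[OF s, THEN monoD, OF True] by simp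
    also have "\<dots> \<le> ?\<tau> x" by simp
    finally show ?thesis using fast_ge le_trans by blast
  next
    case False
    have cl: "coeffs_le (x + 1) d"
      using False by (intro coeffs_le_mono[OF coeffs_le_size]) simp
    have "fast d (x + 1) + ?K \<le> fast d (x + 1 + ?K)" by (rule fast_add_le[OF d cl])
    also have "\<dots> \<le> fast d (?\<tau> x)"
      by (intro fast_mono d coeffs_le_mono[OF cl]) auto
    finally have "fast d (x + 1) + ?K \<le> fast d (?\<tau> x)" .
    moreover have "x + 2 \<le> fast d (x + 1)" using fast_gt[of "x + 1" d] by linarith
    then have "max (s (x + 1)) (x + 2) \<le> fast d (x + 1)" using le[of "x + 1"] by simp
    ultimately have "max (s (x + 1)) (x + 2) + ?K \<le> fast d (?\<tau> x)" by linarith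
    moreover have "?M + ?K \<le> fast d (?\<tau> x)"
      using fast_ge[of "?\<tau> x" d] by linarith
    ultimately show ?thesis by simp
  qed
  obtain j where j: "\<And>x. fast d x \<le> (grz_bound d ^^ j) x"
    using fast_le_grz_bound_funpow[OF d] by blast
  have bound: "?\<tau> x \<le> (grz_bound d ^^ (?M + ?K + j)) x" for x
  proof -
    have "?\<tau> x \<le> fast d x + (?M + ?K)" using le[of x] fast_gt[of x d] by linarith
    also have "\<dots> \<le> (grz_bound d ^^ j) x + (?M + ?K)" using j by simp
    also have "\<dots> \<le> (grz_bound d ^^ (?M + ?K)) ((grz_bound d ^^ j) x)"
      by (rule add_le_grz_bound_funpow)
    finally show ?thesis by (simp only: funpow_add o_apply)
  qed
  show ?thesis
    by (rule FF_s_subset_FF[where \<tau> = ?\<tau>, OF a d mono _ _ _ step bound]) simp_all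
qed

section \<open>The inclusion for s in a Grzegorczyk class\<close>

lemma one_le_cnf:
  assumes "a \<noteq> 0"
  shows "(1 :: cnf) \<le> a"
proof -
  obtain e es where "a = Cnf (e # es)"
    using assms unfolding zero_cnf_def by (metis exponents.cases list.exhaust)
  moreover have "Cnf [] \<le> Cnf es" "0 \<le> e"
    using zero_le_cnf[of "Cnf es"] by (simp_all only: zero_cnf_def[symmetric] zero_le_cnf)
  ultimately show ?thesis by (auto simp: one_cnf_def le_less)
qed

lemma fast_zero_funpow: "(fast 0 ^^ n) x = x + n"
  by (induction n) (simp_all add: fast_s_zero)

lemma fast_one: "fast 1 x = 2 * x + 1"
  using fast_succ[of "[]" x] unfolding one_cnf_def zero_cnf_def[symmetric] append_Nil fast_zero_funpow
  by simp

lemma fast_ge_double: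
  assumes "is_cnf a" and "a \<noteq> 0"
  shows "2 * x + 1 \<le> fast a x"
proof (cases "x = 0")
  case True
  have "1 \<le> fast a 0" using fast_gt[of 0 a] by linarith
  then show ?thesis using True by simp
next
  case False
  \<comment> \<open>The index 1 has coefficient 1, so the comparison of indices starts at x =
    1.\<close>
  then have "coeffs_le x 1" "is_cnf 1"
    by (auto simp: one_cnf_def zero_cnf_def)
  then show ?thesis
    using fast_mono_index_le[OF _ assms(1) one_le_cnf[OF assms(2)]] fast_one by metis
qed

text \<open>The iterates of \<open>fast 0\<close> do not dominate multiplication, which the factor \<open>c\<close> supplies.\<close>

lemma grz_bound_funpow_le_fast:
  assumes a: "is_cnf a"
  shows "\<exists>m c. size a \<le> c \<and> (\<forall>x. (grz_bound a ^^ n) x \<le> (fast a ^^ m) (c * x + c))"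
proof (induction n)
  case 0
  show ?case by (intro exI[of _ 0] exI[of _ "size a + 1"]) simp
next
  case (Suc n)
  then obtain m c where c: "size a \<le> c"
    and m: "\<And>x. (grz_bound a ^^ n) x \<le> (fast a ^^ m) (c * x + c)" by blast
  let ?k = "(fast a ^^ size a) 0"
  show ?case
  proof (cases "a = 0")
    case True
    \<comment> \<open>Iterating \<open>fast 0\<close> only adds, so everything is put into the
      linear factor; \<open>?c\<close> bounds the coefficients of 2 * (c * x + c + m) + ?k +
      1.\<close>
    let ?c = "2 * c + 2 * m + ?k + 1"
    have "(grz_bound a ^^ Suc n) x \<le> (fast a ^^ 0) (?c * x + ?c)" for x
    proof -
      have "(grz_bound a ^^ Suc n) x \<le> grz_bound a (c * x + c + m)"
        using m[of x] mono_grz_bound[OF a] unfolding True fast_zero_funpow by (simp add: monoD)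
      also have "\<dots> = 2 * (c * x + c + m) + ?k + 1"
        by (simp add: grz_bound_def True fast_s_zero)
      also have "\<dots> \<le> ?c * x + ?c"
        by (simp add: algebra_simps)
      finally show ?thesis by simp
    qed
    then show ?thesis using c by (intro exI[of _ 0] exI[of _ ?c]) auto
  next
    case False
    \<comment> \<open>Of the extra iterates, \<open>?k\<close> supply the additive constant, one the
      doubling, and one the outer \<open>fast a\<close>.\<close>
    have "(grz_bound a ^^ Suc n) x \<le> (fast a ^^ (2 + ?k + m)) (c * x + c)" for x
    proof -
      let ?z = "(fast a ^^ m) (c * x + c)"
      have z: "size a \<le> ?z"
        using funpow_ge[of "fast a" "c * x + c" m, OF fast_ge] c by linarith
      have mono: "fast a u \<le> fast a v" if "size a \<le> u" "u \<le> v" for u v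
        using that by (intro fast_mono a coeffs_le_mono[OF coeffs_le_size])
      have "(grz_bound a ^^ Suc n) x \<le> grz_bound a ?z"
        using m mono_grz_bound[OF a] by (simp add: monoD)
      also have "\<dots> \<le> fast a (2 * (?z + ?k) + 1)"
        unfolding grz_bound_def using z by (intro mono) auto
      also have "\<dots> \<le> fast a (fast a (?z + ?k))"
        using z by (intro mono fast_ge_double a False) auto
      also have "\<dots> \<le> fast a (fast a ((fast a ^^ ?k) ?z))"
        using z fast_ge[of "?z + ?k" a] by (intro mono funpow_ge_add fast_gt) linarith+
      also have "\<dots> = (fast a ^^ (2 + ?k + m)) (c * x + c)"
        by (simp only: funpow_add o_apply) (simp add: numeral_2_eq_2)
      finally show ?thesis .
    qed
    then show ?thesis using c by blast
  qed
qed

lemma FF_s_subset_FF_Grz: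
  assumes s: "s \<in> Grz b" and a: "is_cnf a" and b: "is_cnf b"
  shows "FF_s s a \<subseteq> FF (b + 1 + a)"
proof -
  obtain n where n: "\<And>x. s x \<le> (grz_bound b ^^ n) x"
    using Grz_le_grz_bound[OF b s] by blast
  obtain m c where c: "size b \<le> c"
    and m: "\<And>x. (grz_bound b ^^ n) x \<le> (fast b ^^ m) (c * x + c)"
    using grz_bound_funpow_le_fast[OF b] by blast
  let ?d = "b + 1"
  \<comment> \<open>The summand \<open>c\<close> covers the growth of c * x + c when x increases by
    1; the sizes cover the coefficients.\<close>
  let ?K = "c + m + size a + size ?d"
  let ?f = "fast b ^^ m"
  let ?\<tau> = "\<lambda>x. ?f (c * x + c) + ?K"
  have d: "is_cnf ?d" using b by (intro is_cnf_add) (auto simp: one_cnf_def zero_cnf_def)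
  have fast_d: "fast ?d y = (fast b ^^ (y + 1)) y" for y
    using add_Cnf_snoc_zero[of b "[]"] fast_succ[of "exponents b" y]
    unfolding one_cnf_def add_Cnf_simps append_Nil by (cases b) (simp only: exponents.simps)
  have f_mono: "?f u \<le> ?f v" if "size b \<le> u" "u \<le> v" for u v
    using that by (intro funpow_mono_ge[of "size b"] fast_mono b fast_ge
        coeffs_le_mono[OF coeffs_le_size])
  have f_ge: "z + m \<le> ?f z" for z by (intro funpow_ge_add fast_gt)
  have mono: "mono ?\<tau>"
    using c by (intro monoI add_right_mono f_mono) (auto intro: le_trans)
  have step: "?\<tau> (x + 1) \<le> fast ?d (?\<tau> x)" for x
  proof -
    define y where "y = ?\<tau> x"
    have y: "c * x + c + m + ?K \<le> y" using f_ge[of "c * x + c"] by (simp add: y_def)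
    \<comment> \<open>\<open>fast ?d y\<close> iterates \<open>fast b\<close> y + 1 times: m
      iterations dominate the \<open>?f\<close> part, and the other y + 1 - m add at least
      \<open>?K\<close>.\<close>
    have "?\<tau> (x + 1) \<le> ?f y + (y + 1 - m)"
      using y c f_mono[of "c * (x + 1) + c" y] by simp
    also have "\<dots> \<le> (fast b ^^ (y + 1 - m)) (?f y)"
      by (intro funpow_ge_add fast_gt)
    also have "\<dots> = fast ?d y"
      using funpow_add[of "y + 1 - m" m "fast b"] y unfolding fast_d by simp
    finally show ?thesis unfolding y_def .
  qed
  have ge: "x \<le> ?\<tau> x" for x
  proof -
    have "1 \<le> size b" by (cases b) simp
    then have "x \<le> c * x" using c by simp
    then show ?thesis using f_ge[of "c * x + c"] by linarith
  qed
  have s_le: "s x + size ?d \<le> ?\<tau> x" for x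
    using n[of x] m[of x] by linarith
  obtain k where k: "\<And>x. (grz_bound b ^^ (?K + m + c)) x \<le> (grz_bound ?d ^^ k) x"
    using grz_bound_le_index[OF b d le_add_left_cnf] by blast
  have bound: "?\<tau> x \<le> (grz_bound ?d ^^ k) x" for x
  proof -
    have f_le: "(fast b ^^ i) z \<le> (grz_bound b ^^ i) z" if "size b \<le> z" for i z
    proof (induction i)
      case (Suc i)
      have "fast b ((fast b ^^ i) z) \<le> grz_bound b ((fast b ^^ i) z)"
        using that funpow_ge[of "fast b" z i, OF fast_ge] by (intro fast_le_grz_bound b) simp
      then show ?case using Suc mono_grz_bound[OF b] by (auto intro: le_trans monoD)
    qed simp
    have "?\<tau> x \<le> (grz_bound b ^^ m) (c * x + c) + ?K"
      using f_le c by simp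
    also have "(grz_bound b ^^ m) (c * x + c) \<le> (grz_bound b ^^ m) ((grz_bound b ^^ c) x)"
      using grz_bound_funpow_linear[of c x b]
      by (intro funpow_mono mono_grz_bound[OF b]) simp
    also have "\<dots> + ?K \<le> (grz_bound b ^^ ?K) ((grz_bound b ^^ m) ((grz_bound b ^^ c) x))"
      by (rule add_le_grz_bound_funpow)
    also have "\<dots> = (grz_bound b ^^ (?K + m + c)) x"
      by (simp only: funpow_add o_apply)
    also have "\<dots> \<le> (grz_bound ?d ^^ k) x" by (rule k)
    finally show ?thesis by simp
  qed
  show ?thesis
    by (rule FF_s_subset_FF[where \<tau> = ?\<tau>, OF a d mono s_le ge _ step bound]) simp
qed

theorem theorem4p4:
  fixes s :: "nat \<Rightarrow> nat" and \<alpha> \<beta> :: cnf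
  assumes "strict_mono s" and "is_cnf \<alpha>" and "is_cnf \<beta>"
  shows "(s \<in> Grz \<beta> \<longrightarrow> FF_s s \<alpha> \<subseteq> FF (\<beta> + 1 + \<alpha>)) \<and>
         ((\<forall>x. s x \<le> fast \<beta> x) \<longrightarrow> FF_s s \<alpha> \<subseteq> FF (\<beta> + \<alpha>))"
  using FF_s_subset_FF_Grz[OF _ assms(2,3)] FF_s_subset_FF_pointwise[OF assms] by simp

end
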